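(* Let $n\ge 1$ be a natural number and let $\mu$ be a finite measure on $\mathcal{T}=[0,1]$. A pure-strategy Nash equilibrium exists in the producer game with fine preferences $(n,\mu,\succeq_F)$, and it is unique up to permutations of the producers. The sorted Nash-equilibrium strategies $t_0\le\cdots\le t_{n-1}\in\mathcal{T}$ are given by $$t_j=\max\Bigl\{t\in\mathcal{T}\;\Big|\;\mu\bigl([0,t)\bigr)\le\tfrac{j}{n}\cdot\mu(\mathcal{T})\Bigr\}\qquad\text{for every } j\in\mathbb{P}_n.$$ The load on each producer in this equilibrium is $\frac{\mu(\mathcal{T})}{n}$. Furthermore, this equilibrium is super-strong.
   Context: Notation: $\mathcal{T}=[0,1]$ (with the Borel $\sigma$-algebra), $\mathbb{P}_n=\{0,1,\ldots,n-1\}$. Consumer game $(\mu;\bar t)$, for $\bar t=(t_0,\ldots,t_{n-1})\in\mathcal{T}^{\mathbb{P}_n}$. Consumers of types $d\in\mathcal{T}$ are distributed according to $\mu$. The strategies of type $d$ are $S_d=\{j\in\mathbb{P}_n\mid t_j\le d\}\cup\{\lnot\}$ ($\lnot$ means "not consuming"); $S=\mathbb{P}_n\cup\{\lnot\}$. A mixed-consumption profile is a measurable $s:\mathcal{T}\to[0,1]^S$ such that, for every $d$, $s(d)$ is a probability vector on $S$ supported in $S_d$; its loads are $\ell^s_j=\int_{\mathcal{T}}s_j\,d\mu$. It is a Nash equilibrium if for every $d\in\mathcal{T}$: $\lnot\in\operatorname{supp}(s(d))$ only if $S_d=\{\lnot\}$, and $\ell^s_k\le\ell^s_j$ for all $k\in\operatorname{supp}(s(d))$,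 $j\in S_d\setminus\{\lnot\}$. Such equilibria exist and all have the same producer loads; $\ell_j(\bar t)$ denotes the load $\ell^s_j$ of producer $j\in\mathbb{P}_n$ in any such equilibrium $s$. Producer game with fine preferences $(n,\mu,\succeq_F)$: the players are the producers $\mathbb{P}_n$, each with pure-strategy set $\mathcal{T}$. Producer $j$ strictly prefers profile $\bar t$ to profile $\bar t'$ iff $\ell_j(\bar t)>\ell_j(\bar t')$, or $\ell_j(\bar t)=\ell_j(\bar t')$ and $t_j>t'_j$. A Nash equilibrium $\bar t$ is super-strong if there are no coalition $P\subseteq\mathbb{P}_n$ and strategies $(t'_j)_{j\in P}$ such that every $j\in P$ weakly prefers the profile obtained from $\bar t$ by replacing $t_j$ with $t'_j$ for all $j\in P$ over $\bar t$, with strict preference for at least one $j\in P$. *)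

theory Defs
  imports "HOL-Analysis.Analysis"
begin

text \<open>The producers are \<open>{..<n}\<close> and both the consumer types and the producers'
  strategies are the reals in \<open>{0..1}\<close>. A consumer strategy is \<open>Some j\<close>
  (consuming from producer \<open>j\<close>) or \<open>None\<close> (not consuming). Profiles of producer
  strategies are extensional functions, so that equality of profiles is function equality.\<close>

definition all_strategies :: "nat \<Rightarrow> nat option set" where
  "all_strategies n = Some ` {..<n} \<union> {None}"

definition type_strategies :: "nat \<Rightarrow> (nat \<Rightarrow> real) \<Rightarrow> real \<Rightarrow> nat option set" where
  "type_strategies n t d = Some ` {j \<in> {..<n}. t j \<le> d} \<union> {None}"

definition supp :: "nat \<Rightarrow> (nat option \<Rightarrow> real) \<Rightarrow> nat option set" where
  "supp n p = {a \<in> all_strategies n. p a \<noteq> 0}"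

definition consumption_profile ::
    "real measure \<Rightarrow> nat \<Rightarrow> (nat \<Rightarrow> real) \<Rightarrow> (real \<Rightarrow> nat option \<Rightarrow> real) \<Rightarrow> bool" where
  "consumption_profile M n t s \<longleftrightarrow>
     s \<in> M \<rightarrow>\<^sub>M Pi\<^sub>M (all_strategies n) (\<lambda>_. restrict_space borel {0..1}) \<and>
     (\<forall>d\<in>{0..1}. (\<Sum>a\<in>all_strategies n. s d a) = 1 \<and> supp n (s d) \<subseteq> type_strategies n t d)"

definition profile_load :: "real measure \<Rightarrow> (real \<Rightarrow> nat option \<Rightarrow> real) \<Rightarrow> nat \<Rightarrow> real" where
  "profile_load M s j = (LINT d|M. s d (Some j))"

definition consumer_nash ::
    "real measure \<Rightarrow> nat \<Rightarrow> (nat \<Rightarrow> real) \<Rightarrow> (real \<Rightarrow> nat option \<Rightarrow> real) \<Rightarrow> bool" where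
  "consumer_nash M n t s \<longleftrightarrow>
     consumption_profile M n t s \<and>
     (\<forall>d\<in>{0..1}.
        (None \<in> supp n (s d) \<longrightarrow> type_strategies n t d = {None}) \<and>
        (\<forall>k j. Some k \<in> supp n (s d) \<longrightarrow> Some j \<in> type_strategies n t d \<longrightarrow>
           profile_load M s k \<le> profile_load M s j))"

text \<open>The description is proper because consumer equilibria exist and all have the same
  producer loads.\<close>

definition load :: "real measure \<Rightarrow> nat \<Rightarrow> (nat \<Rightarrow> real) \<Rightarrow> nat \<Rightarrow> real" where
  "load M n t j = (THE x. \<exists>s. consumer_nash M n t s \<and> x = profile_load M s j)"

definition producer_profiles :: "nat \<Rightarrow> (nat \<Rightarrow> real) set" where
  "producer_profiles n = {..<n} \<rightarrow>\<^sub>E {0..1}"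

definition fine_strict_pref ::
    "real measure \<Rightarrow> nat \<Rightarrow> nat \<Rightarrow> (nat \<Rightarrow> real) \<Rightarrow> (nat \<Rightarrow> real) \<Rightarrow> bool" where
  "fine_strict_pref M n j t t' \<longleftrightarrow>
     load M n t j > load M n t' j \<or> load M n t j = load M n t' j \<and> t j > t' j"

text \<open>The strict preference is a strict weak order (lexicographic in load and price), so weak
  preference is the negation of the reverse strict preference.\<close>

definition fine_weak_pref ::
    "real measure \<Rightarrow> nat \<Rightarrow> nat \<Rightarrow> (nat \<Rightarrow> real) \<Rightarrow> (nat \<Rightarrow> real) \<Rightarrow> bool" where
  "fine_weak_pref M n j t t' \<longleftrightarrow> \<not> fine_strict_pref M n j t' t"

definition producer_nash :: "real measure \<Rightarrow> nat \<Rightarrow> (nat \<Rightarrow> real) \<Rightarrow> bool" where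
  "producer_nash M n t \<longleftrightarrow>
     t \<in> producer_profiles n \<and>
     (\<forall>j<n. \<forall>x\<in>{0..1}. fine_weak_pref M n j t (t(j := x)))"

definition super_strong :: "real measure \<Rightarrow> nat \<Rightarrow> (nat \<Rightarrow> real) \<Rightarrow> bool" where
  "super_strong M n t \<longleftrightarrow>
     producer_nash M n t \<and>
     \<not> (\<exists>P t'. P \<subseteq> {..<n} \<and> (\<forall>j\<in>P. t' j \<in> {0..1}) \<and>
          (\<forall>j\<in>P. fine_weak_pref M n j (override_on t t' P) t) \<and>
          (\<exists>j\<in>P. fine_strict_pref M n j (override_on t t' P) t))"

text \<open>Stated as a relation since \<open>Max\<close> is only meaningful for finite sets; it includes
  that the maximum is attained.\<close>

definition is_maximum :: "real \<Rightarrow> real set \<Rightarrow> bool" where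
  "is_maximum x A \<longleftrightarrow> x \<in> A \<and> (\<forall>y\<in>A. y \<le> x)"

end

(* Let L be the average load and G(x) the mass of [0,x).  Consumer equilibria balance the loads as
   far as affordability permits: the producers with load below a level serve exactly the consumers
   who can afford the cheapest of them.  Hence all loads equal L iff G(t_j) <= L |{i. t_i < t_j}|
   for all j (feasibility).  Price 0 secures a load of at least L against any opponents, so in
   equilibrium all loads equal L, and prices must be so high that no single raise stays feasible
   (saturation); feasibility and saturation determine the sorted prices.  If a coalition deviated
   without loss, the producers with load below L would lie outside it and have kept their prices,
   which feasibility of the original prices excludes; so all loads are still L, the gain is a
   raised price, and the new prices are feasible, against saturation. *)

theory Submission imports Defs begin

section \<open>Water filling and balanced assignments\<close>

text \<open>The amount that fills all resources up to level \<open>c\<close> is continuous in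
  \<open>c\<close>, vanishes at the least height \<open>l\<close>, and is at least \<open>w\<close>
  at distance \<open>w\<close> above any height; the intermediate value theorem gives the
  level.\<close>

lemma water_level:
  fixes l :: "'a \<Rightarrow> real"
  assumes "finite A" "A \<noteq> {}" "0 \<le> w"
  shows "\<exists>c. (\<Sum>j\<in>A. max 0 (c - l j)) = w"
proof -
  obtain j where j: "j \<in> A" using assms by auto
  define f where "f c = (\<Sum>j\<in>A. max 0 (c - l j))" for c
  have "f (Min (l ` A)) = 0"
    unfolding f_def using assms by (intro sum.neutral) auto
  moreover have "w \<le> f (l j + w)"
    using member_le_sum[OF j, of "\<lambda>i. max 0 (l j + w - l i)"] assms by (simp add: f_def)
  moreover have "Min (l ` A) \<le> l j + w"
    using Min_le[OF finite_imageI[OF assms(1)] imageI[OF j], of l] assms(3) by linarith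
  moreover have "continuous_on {Min (l ` A)..l j + w} f"
    unfolding f_def by (intro continuous_intros)
  ultimately show ?thesis
    using IVT'[of f "Min (l ` A)" w "l j + w"] assms by (auto simp: f_def)
qed

text \<open>The groups are served in turn, each filling the least loaded resources up to a common
  level. As the choice sets increase, serving group \<open>K\<close> replaces every load \<open>l\<close> on the choice
  sets of the earlier groups by \<open>max l c\<close>, which preserves their optimality.\<close>

lemma balanced_assignment:
  fixes A :: "nat \<Rightarrow> 'a set" and m :: "nat \<Rightarrow> real"
  assumes fin: "\<And>k. finite (A k)" and mono: "mono A" and m: "\<And>k. 0 \<le> m k"
  shows "\<exists>x. \<forall>k<K. (\<forall>j. 0 \<le> x k j) \<and> (\<forall>j. j \<notin> A k \<longrightarrow> x k j = 0) \<and>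
      (A k \<noteq> {} \<longrightarrow> (\<Sum>j\<in>A k. x k j) = 1) \<and>
      (\<forall>i\<in>A k. \<forall>j. x k j \<noteq> 0 \<longrightarrow> (\<Sum>l<K. m l * x l j) \<le> (\<Sum>l<K. m l * x l i))"
    (is "\<exists>x. \<forall>k<K. ?P K x k")
proof (induction K)
  case 0
  show ?case by simp
next
  case (Suc K)
  then obtain x where "\<forall>k<K. ?P K x k" by blast
  then have x: "\<And>k j. k < K \<Longrightarrow> 0 \<le> x k j" "\<And>k j. k < K \<Longrightarrow> j \<notin> A k \<Longrightarrow> x k j = 0"
      "\<And>k. k < K \<Longrightarrow> A k \<noteq> {} \<Longrightarrow> (\<Sum>j\<in>A k. x k j) = 1"
      "\<And>k i j. k < K \<Longrightarrow> i \<in> A k \<Longrightarrow> x k j \<noteq> 0 \<Longrightarrow> (\<Sum>l<K. m l * x l j) \<le> (\<Sum>l<K. m l * x l i)"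
    by blast+
  define l where "l j = (\<Sum>k<K. m k * x k j)" for j
  have "\<exists>y c. (\<forall>j. 0 \<le> y j) \<and> (\<forall>j. j \<notin> A K \<longrightarrow> y j = 0) \<and>
      (A K \<noteq> {} \<longrightarrow> (\<Sum>j\<in>A K. y j) = 1) \<and>
      (\<forall>j\<in>A K. m K * y j = max 0 (c - l j)) \<and> (\<forall>j. y j \<noteq> 0 \<longrightarrow> l j \<le> c)"
  proof (cases "A K = {}")
    case True
    then show ?thesis by (intro exI[of _ "\<lambda>_. 0"]) auto
  next
    case ne: False
    show ?thesis
    proof (cases "m K = 0")
      case True
      \<comment> \<open>A group without mass leaves the loads unchanged, but its choice must still
        be optimal: it goes to a least loaded resource, whose load serves as
        \<open>c\<close>.\<close>
      have "Min (l ` A K) \<in> l ` A K" using fin ne by simp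
      then obtain i where i: "i \<in> A K" "l i = Min (l ` A K)" by auto
      then have "l i \<le> l j" if "j \<in> A K" for j using that fin by simp
      then show ?thesis using True i fin
        by (intro exI[of _ "\<lambda>j. if j = i then 1 else 0"] exI[of _ "l i"]) auto
    next
      case False
      with m[of K] have pos: "m K > 0" by simp
      obtain c where c: "(\<Sum>j\<in>A K. max 0 (c - l j)) = m K"
        using water_level[OF fin ne m, of l] by blast
      have "(\<Sum>j\<in>A K. max 0 (c - l j) / m K) = 1"
        using c pos by (simp flip: sum_divide_distrib)
      then show ?thesis using pos
        by (intro exI[of _ "\<lambda>j. if j \<in> A K then max 0 (c - l j) / m K else 0"] exI[of _ c])
           (auto simp: max_def)
    qed
  qed
  then obtain y c where y: "\<And>j. 0 \<le> y j" "\<And>j. j \<notin> A K \<Longrightarrow> y j = 0"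
      "A K \<noteq> {} \<Longrightarrow> (\<Sum>j\<in>A K. y j) = 1"
      "\<And>j. j \<in> A K \<Longrightarrow> m K * y j = max 0 (c - l j)" "\<And>j. y j \<noteq> 0 \<Longrightarrow> l j \<le> c"
    by blast
  define z where "z = x(K := y)"
  have load: "(\<Sum>k<Suc K. m k * z k j) = max (l j) c" if "j \<in> A K" for j
    using y(4)[OF that] by (simp add: z_def l_def)
  have sub: "A k \<subseteq> A K" if "k < Suc K" for k
    using mono that by (simp add: monoD)
  have "(\<Sum>k<Suc K. m k * z k j) \<le> (\<Sum>k<Suc K. m k * z k i)"
    if k: "k < Suc K" and i: "i \<in> A k" and j: "z k j \<noteq> 0" for k i j
  proof -
    have "j \<in> A k"
      using x(2)[of k j] y(2)[of j] j k by (cases "k = K") (auto simp: z_def)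
    moreover have "max (l j) c \<le> max (l i) c"
    proof (cases "k = K")
      case True
      then show ?thesis using y(5)[of j] j by (simp add: z_def)
    next
      case False
      then have "l j \<le> l i" using x(4)[of k i j] k i j by (simp add: z_def l_def)
      then show ?thesis by simp
    qed
    ultimately show ?thesis using load sub[OF k] i by (metis subsetD)
  qed
  moreover have "(\<forall>j. 0 \<le> z k j) \<and> (\<forall>j. j \<notin> A k \<longrightarrow> z k j = 0) \<and>
      (A k \<noteq> {} \<longrightarrow> (\<Sum>j\<in>A k. z k j) = 1)" if "k < Suc K" for k
    using x(1,2,3)[of k] y(1,2,3) that by (cases "k = K") (auto simp: z_def)
  ultimately show ?case by (intro exI[of _ z]) blast
qed

section \<open>Counting and sorting\<close>

lemma sum_all_strategies:
  "(\<Sum>a\<in>all_strategies n. f a) = f None + (\<Sum>j<n. f (Some j) :: real)"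
proof -
  have "(\<Sum>a\<in>all_strategies n. f a) = f None + (\<Sum>a\<in>Some ` {..<n}. f a)"
    unfolding all_strategies_def by (simp add: image_iff)
  also have "(\<Sum>a\<in>Some ` {..<n}. f a) = (\<Sum>j<n. f (Some j))"
    by (simp add: sum.reindex)
  finally show ?thesis .
qed

lemma card_split: "real n = real (card {k. k < n \<and> P k}) + real (card {k. k < n \<and> \<not> P k})"
proof -
  have "card {..<n} = card ({k. k < n \<and> P k} \<union> {k. k < n \<and> \<not> P k})"
    by (intro arg_cong[of _ _ card]) auto
  also have "\<dots> = card {k. k < n \<and> P k} + card {k. k < n \<and> \<not> P k}"
    by (intro card_Un_disjoint) auto
  finally show ?thesis by simp
qed

text \<open>By monotonicity the set is an initial segment of the naturals, which is determined by
  its size.\<close>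

lemma mono_on_less_eq_lessThan:
  fixes t :: "nat \<Rightarrow> real"
  assumes mono: "mono_on {..<n} t"
  shows "{i. i < n \<and> t i < x} = {..<card {i. i < n \<and> t i < x}}"
proof -
  let ?S = "{i. i < n \<and> t i < x}"
  define k where "k = (LEAST k. k \<notin> ?S)"
  have k: "k \<notin> ?S" unfolding k_def by (rule LeastI[of _ n]) simp
  have "i \<in> ?S" if "i < k" for i
    using not_less_Least[of i "\<lambda>k. k \<notin> ?S"] that unfolding k_def by blast
  moreover have "i < k" if i: "i \<in> ?S" for i
  proof (rule ccontr)
    assume "\<not> i < k"
    then have "t k \<le> t i" using mono_onD[OF mono, of k i] i by simp
    then show False using k i \<open>\<not> i < k\<close> by auto
  qed
  ultimately have "?S = {..<k}" by blast
  then show ?thesis by simp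
qed

lemma is_maximum_unique: "is_maximum x S \<Longrightarrow> is_maximum y S \<Longrightarrow> x = y"
  unfolding is_maximum_def by (rule antisym) blast+

text \<open>This lets \<open>feasible\<close> and \<open>saturated\<close>, which see the other
  producers only through such counts, pass to the sorted prices.\<close>

lemma permuted_card_less:
  assumes p: "p permutes {..<n}"
  shows "card {i. i < n \<and> t (p i) < x} = card {i. i < n \<and> t i < (x::real)}"
proof -
  have n: "p i < n \<longleftrightarrow> i < n" for i using permutes_in_image[OF p, of i] by simp
  have "p ` {i. i < n \<and> t (p i) < x} = {i. i < n \<and> t i < x}"
  proof (intro equalityI subsetI)
    fix i assume i: "i \<in> {i. i < n \<and> t i < x}"
    obtain k where k: "i = p k" using permutes_surj[OF p] by (meson surjD)
    then have "k \<in> {i. i < n \<and> t (p i) < x}" using i n[of k] by simp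
    then show "i \<in> p ` {i. i < n \<and> t (p i) < x}" unfolding k by (rule imageI)
  qed (use n in auto)
  then show ?thesis
    using card_image[OF permutes_inj_on[OF p], of "{i. i < n \<and> t (p i) < x}"] by argo
qed

text \<open>The sorted list of values has the same multiset of entries as \<open>t\<close>, so a
  permutation of the indices relates the two.\<close>

lemma sorting_permutation:
  fixes t :: "nat \<Rightarrow> 'a::linorder"
  obtains p where "p permutes {..<n}" "mono_on {..<n} (\<lambda>i. t (p i))"
proof -
  let ?l = "sort (map t [0..<n])"
  have "image_mset (\<lambda>i. ?l ! i) (mset_set {..<n}) = mset (map (\<lambda>i. ?l ! i) [0..<length ?l])"
    by (simp add: mset_set_upto_eq_mset_upto)
  also have "\<dots> = image_mset t (mset_set {..<n})"
    unfolding map_nth by (simp add: mset_set_upto_eq_mset_upto)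
  finally have "image_mset (\<lambda>i. ?l ! i) (mset_set {..<n}) = image_mset t (mset_set {..<n})" .
  then obtain p where p: "p permutes {..<n}" "\<forall>i\<in>{..<n}. ?l ! i = t (p i)"
    by (rule image_mset_eq_implies_permutes[OF finite_lessThan])
  have "mono_on {..<n} (\<lambda>i. t (p i))"
  proof (rule mono_onI)
    fix i k assume "i \<in> {..<n}" "k \<in> {..<n}" "i \<le> k"
    then show "t (p i) \<le> t (p k)"
      using sorted_nth_mono[of ?l i k] p(2) by simp
  qed
  with p(1) show ?thesis by (rule that)
qed

section \<open>Consumption profiles and their loads\<close>

locale consumer_market = finite_measure M for M :: "real measure" +
  fixes n :: nat
  assumes n_pos: "n \<ge> 1"
    and sets_eq: "sets M = sets (restrict_space borel {0..1})"
begin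

lemma space_eq: "space M = {0..1}"
  using sets_eq_imp_space_eq[OF sets_eq] by (simp add: space_restrict_space)

lemma Collect_in_sets:
  assumes "{d. P d} \<in> sets borel"
  shows "{d \<in> {0..1}. P d} \<in> sets M"
proof -
  have "{d \<in> {0..1}. P d} = {0..1} \<inter> {d. P d}" by auto
  then show ?thesis unfolding sets_eq sets_restrict_space using assms by blast
qed

lemma consumption_profileD:
  assumes "consumption_profile M n t s" and d: "d \<in> {0..1}"
  shows "s d None + (\<Sum>j<n. s d (Some j)) = 1"
    and "j < n \<Longrightarrow> 0 \<le> s d (Some j)" and "0 \<le> s d None"
    and "j < n \<Longrightarrow> d < t j \<Longrightarrow> s d (Some j) = 0"
proof -
  have s: "s \<in> M \<rightarrow>\<^sub>M Pi\<^sub>M (all_strategies n) (\<lambda>_. restrict_space borel {0..1})"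
    using assms by (simp add: consumption_profile_def)
  have "s d \<in> all_strategies n \<rightarrow>\<^sub>E {0..1}"
    using measurable_space[OF s, of d] d
    by (simp add: space_eq space_PiM space_restrict_space)
  then have "s d a \<in> {0..1}" if "a \<in> all_strategies n" for a
    using that by (rule PiE_mem)
  then show "0 \<le> s d None" "j < n \<Longrightarrow> 0 \<le> s d (Some j)"
    by (auto simp: all_strategies_def)
  show "s d None + (\<Sum>j<n. s d (Some j)) = 1"
    using assms by (simp add: consumption_profile_def flip: sum_all_strategies)
  show "s d (Some j) = 0" if "j < n" "d < t j"
  proof (rule ccontr)
    assume "s d (Some j) \<noteq> 0"
    then have "Some j \<in> supp n (s d)"
      using that by (simp add: supp_def all_strategies_def)
    then have "Some j \<in> type_strategies n t d"
      using assms by (auto simp: consumption_profile_def)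
    then show False
      using that by (auto simp: type_strategies_def)
  qed
qed

lemma integrable_profile:
  assumes s: "consumption_profile M n t s" and j: "j < n"
  shows "integrable M (\<lambda>d. s d (Some j))"
proof (rule integrable_const_bound[where B = 1])
  have "s \<in> M \<rightarrow>\<^sub>M Pi\<^sub>M (all_strategies n) (\<lambda>_. restrict_space borel {0..1})"
    using s by (simp add: consumption_profile_def)
  then have "(\<lambda>d. s d (Some j)) \<in> M \<rightarrow>\<^sub>M restrict_space borel {0..1}"
    by (rule measurable_compose[OF _ measurable_component_singleton])
       (use j in \<open>simp add: all_strategies_def\<close>)
  then show "(\<lambda>d. s d (Some j)) \<in> borel_measurable M"
    by (simp add: measurable_restrict_space2_iff)
  have "norm (s d (Some j)) \<le> 1" if d: "d \<in> space M" for d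
  proof -
    note D = consumption_profileD[OF s d[unfolded space_eq]]
    have "s d (Some j) \<le> (\<Sum>j<n. s d (Some j))"
      by (rule member_le_sum) (use D j in auto)
    then show ?thesis using D(1,2,3) j by simp
  qed
  then show "AE d in M. norm (s d (Some j)) \<le> 1" by simp
qed

text \<open>The weights \<open>c\<close> will be the loads in the variational inequality and the
  constant 1 in the bounds on sums of loads.\<close>

lemma sum_profile_load:
  assumes s: "consumption_profile M n t s" and "U \<subseteq> {..<n}"
  shows "integrable M (\<lambda>d. \<Sum>j\<in>U. c j * s d (Some j))"
    and "(\<Sum>j\<in>U. c j * profile_load M s j) = (LINT d|M. (\<Sum>j\<in>U. c j * s d (Some j)))"
proof -
  have int: "integrable M (\<lambda>d. c j * s d (Some j))" if "j \<in> U" for j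
    using integrable_profile[OF s, of j] that assms by auto
  then show "integrable M (\<lambda>d. \<Sum>j\<in>U. c j * s d (Some j))" by simp
  show "(\<Sum>j\<in>U. c j * profile_load M s j) = (LINT d|M. (\<Sum>j\<in>U. c j * s d (Some j)))"
    using int by (simp add: profile_load_def)
qed

section \<open>Consumer equilibria: uniqueness of the loads and existence\<close>

lemma consumer_nashD:
  assumes s: "consumer_nash M n t s" and d: "d \<in> {0..1}" and i: "i < n" "t i \<le> d"
  shows "s d None = 0"
    and "k < n \<Longrightarrow> s d (Some k) \<noteq> 0 \<Longrightarrow> profile_load M s k \<le> profile_load M s i"
proof -
  have i': "Some i \<in> type_strategies n t d"
    using i by (simp add: type_strategies_def)
  then have "None \<notin> supp n (s d)"
    using s d by (auto simp: consumer_nash_def)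
  then show "s d None = 0"
    by (simp add: supp_def all_strategies_def)
  show "profile_load M s k \<le> profile_load M s i" if "k < n" "s d (Some k) \<noteq> 0"
  proof -
    have "Some k \<in> supp n (s d)"
      using that by (simp add: supp_def all_strategies_def)
    then show ?thesis using s d i' by (auto simp: consumer_nash_def)
  qed
qed

lemma consumer_nash_sum:
  assumes s: "consumer_nash M n t s" and d: "d \<in> {0..1}" and i: "i < n" "t i \<le> d"
  shows "(\<Sum>j<n. s d (Some j)) = 1"
proof -
  have "consumption_profile M n t s" using s unfolding consumer_nash_def by (rule conjunct1)
  then show ?thesis
    using consumption_profileD(1)[of t s d] d consumer_nashD(1)[OF assms] by simp
qed

text \<open>At the loads of \<open>s\<close>, no strategy gives a consumer a smaller average load than that of \<open>s\<close>;
  the inequality integrates this over the consumers.\<close>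

lemma load_variational_inequality:
  assumes s: "consumer_nash M n t s" and s': "consumer_nash M n t s'"
  shows "(\<Sum>j<n. profile_load M s j * profile_load M s j)
    \<le> (\<Sum>j<n. profile_load M s j * profile_load M s' j)"
proof -
  let ?l = "profile_load M s"
  have p: "consumption_profile M n t s" "consumption_profile M n t s'"
    using assms by (auto simp: consumer_nash_def)
  have "(\<Sum>j<n. ?l j * s d (Some j)) \<le> (\<Sum>j<n. ?l j * s' d (Some j))"
    if "d \<in> space M" for d
  proof (cases "\<exists>i<n. t i \<le> d")
    case False
    then have "s d (Some j) = 0" "s' d (Some j) = 0" if "j < n" for j
      using that \<open>d \<in> space M\<close> consumption_profileD(4) p by (auto simp: space_eq not_le)
    then show ?thesis by simp
  next
    case True
    \<comment> \<open>The least load affordable to \<open>d\<close>: the equilibrium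
      \<open>s\<close> gives weight only to producers with this load, and \<open>s'\<close> only to
      producers with at least this load.\<close>
    define c where "c = Min (?l ` {i. i < n \<and> t i \<le> d})"
    have c: "c \<in> ?l ` {i. i < n \<and> t i \<le> d}"
      unfolding c_def using True by (intro Min_in) auto
    then obtain i where i: "i < n" "t i \<le> d" "c = ?l i" by auto
    have d: "d \<in> {0..1}" using that by (simp add: space_eq)
    have "?l j * s d (Some j) \<le> c * s d (Some j)" if "j < n" for j
      using consumer_nashD(2)[OF s d i(1,2), of j] consumption_profileD(2)[OF p(1) d] that
      by (cases "s d (Some j) = 0") (auto simp: i(3) intro!: mult_right_mono)
    then have "(\<Sum>j<n. ?l j * s d (Some j)) \<le> (\<Sum>j<n. c * s d (Some j))"
      by (intro sum_mono) auto
    \<comment> \<open>That \<open>s'\<close> is an equilibrium matters here: as some producer is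
      affordable, both profiles put total weight 1 on the producers.\<close>
    also have "\<dots> = (\<Sum>j<n. c * s' d (Some j))"
      using consumer_nash_sum[OF s d i(1,2)] consumer_nash_sum[OF s' d i(1,2)]
      by (simp flip: sum_distrib_left)
    also have "\<dots> \<le> (\<Sum>j<n. ?l j * s' d (Some j))"
    proof (rule sum_mono)
      fix j assume j: "j \<in> {..<n}"
      show "c * s' d (Some j) \<le> ?l j * s' d (Some j)"
      proof (cases "d < t j")
        case True
        then show ?thesis using consumption_profileD(4)[OF p(2) d, of j] j by simp
      next
        case False
        then have "c \<le> ?l j" unfolding c_def using j by (intro Min_le) auto
        then show ?thesis using consumption_profileD(2)[OF p(2) d, of j] j
          by (intro mult_right_mono) auto
      qed
    qed
    finally show ?thesis .
  qed
  then have "(LINT d|M. (\<Sum>j<n. ?l j * s d (Some j))) \<le> (LINT d|M. (\<Sum>j<n. ?l j * s' d (Some j)))"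
    by (intro integral_mono sum_profile_load(1)[of t]) (use p in auto)
  then show ?thesis
    using p by (simp add: sum_profile_load(2)[of t])
qed

text \<open>Adding the variational inequalities of the two equilibria bounds the squared distance of
  their load vectors by 0.\<close>

lemma profile_load_unique:
  assumes s: "consumer_nash M n t s" and s': "consumer_nash M n t s'" and j: "j < n"
  shows "profile_load M s j = profile_load M s' j"
proof -
  let ?l = "profile_load M s" and ?l' = "profile_load M s'"
  have "(\<Sum>j<n. (?l j - ?l' j)\<^sup>2) = (\<Sum>j<n. ?l j * ?l j) - (\<Sum>j<n. ?l j * ?l' j)
      + (\<Sum>j<n. ?l' j * ?l' j) - (\<Sum>j<n. ?l' j * ?l j)"
    by (simp add: power2_eq_square algebra_simps sum.distrib sum_subtractf sum_distrib_left)
  also have "\<dots> \<le> 0"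
    using load_variational_inequality[OF s s'] load_variational_inequality[OF s' s] by simp
  finally have "(\<Sum>j<n. (?l j - ?l' j)\<^sup>2) = 0"
    by (intro antisym sum_nonneg) auto
  then show ?thesis
    using j by (simp add: sum_nonneg_eq_0_iff)
qed

text \<open>The choice set \<open>{j. t j \<le> d}\<close> of a consumer \<open>d\<close> depends only on its size \<open>g d\<close>, and
  it increases with that size.\<close>

lemma consumer_nash_exists: "\<exists>s. consumer_nash M n t s"
proof -
  define g where "g d = card {j. j < n \<and> t j \<le> d}" for d
  \<comment> \<open>Since \<open>t j \<le> d\<close> iff \<open>g (t j) \<le> g d\<close>, this is
    the choice set of size \<open>k\<close> if there is one. For other \<open>k\<close> it still
    makes sense, so \<open>A\<close> is monotone on all naturals.\<close>
  define A where "A k = {j. j < n \<and> g (t j) \<le> k}" for k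
  define m where "m k = measure M {d \<in> space M. g d = k}" for k
  have A: "A (g d) = {j. j < n \<and> t j \<le> d}" for d
  proof -
    have "g (t j) \<le> g d \<longleftrightarrow> t j \<le> d" if j: "j < n" for j
    proof
      assume "t j \<le> d"
      then show "g (t j) \<le> g d" unfolding g_def by (intro card_mono) auto
    next
      assume le: "g (t j) \<le> g d"
      show "t j \<le> d"
      proof (rule ccontr)
        assume "\<not> t j \<le> d"
        then have "{i. i < n \<and> t i \<le> d} \<subset> {i. i < n \<and> t i \<le> t j}"
          using j by (intro psubsetI subsetI) auto
        then have "g d < g (t j)" unfolding g_def by (intro psubset_card_mono) auto
        with le show False by simp
      qed
    qed
    then show ?thesis unfolding A_def by blast
  qed
  have "\<exists>x. \<forall>k<Suc n. (\<forall>j. 0 \<le> x k j) \<and> (\<forall>j. j \<notin> A k \<longrightarrow> x k j = 0) \<and>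
      (A k \<noteq> {} \<longrightarrow> (\<Sum>j\<in>A k. x k j) = 1) \<and>
      (\<forall>i\<in>A k. \<forall>j. x k j \<noteq> 0 \<longrightarrow> (\<Sum>l<Suc n. m l * x l j) \<le> (\<Sum>l<Suc n. m l * x l i))"
    (is "\<exists>x. \<forall>k<Suc n. ?P x k")
    by (rule balanced_assignment) (auto simp: A_def m_def intro!: monoI)
  then obtain x where "\<forall>k<Suc n. ?P x k" by blast
  then have x: "\<And>k j. k < Suc n \<Longrightarrow> 0 \<le> x k j"
      "\<And>k j. k < Suc n \<Longrightarrow> j \<notin> A k \<Longrightarrow> x k j = 0"
      "\<And>k. k < Suc n \<Longrightarrow> A k \<noteq> {} \<Longrightarrow> (\<Sum>j\<in>A k. x k j) = 1"
      "\<And>k i j. k < Suc n \<Longrightarrow> i \<in> A k \<Longrightarrow> x k j \<noteq> 0 \<Longrightarrow>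
        (\<Sum>l<Suc n. m l * x l j) \<le> (\<Sum>l<Suc n. m l * x l i)"
    by blast+
  have gn: "g d < Suc n" for d
  proof -
    have "g d \<le> card {..<n}" unfolding g_def by (intro card_mono) auto
    then show ?thesis by simp
  qed
  \<comment> \<open>Sizes above \<open>n\<close> do not occur; the value 0 there keeps
    \<open>y\<close> in the unit interval for every \<open>k\<close>, so that measurability reduces
    to that of \<open>g\<close>. Types without an affordable producer get
    \<open>None\<close>.\<close>
  define y where "y k a = (case a of Some j \<Rightarrow> if k < Suc n then x k j else 0
    | None \<Rightarrow> if A k = {} then 1 else 0)" for k a
  define s where "s d = (\<lambda>a\<in>all_strategies n. y (g d) a)" for d
  have y_sum: "(\<Sum>a\<in>all_strategies n. y (g d) a) = 1" for d
  proof -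
    have "(\<Sum>j<n. x (g d) j) = (\<Sum>j\<in>A (g d). x (g d) j)"
      by (rule sum.mono_neutral_right) (use x(2)[OF gn] in \<open>auto simp: A_def\<close>)
    then show ?thesis using x(3)[OF gn, of d] gn[of d] by (auto simp: sum_all_strategies y_def)
  qed
  have y_range: "y k a \<in> {0..1}" if "a \<in> all_strategies n" for k a
  proof (cases a)
    case None
    then show ?thesis by (simp add: y_def)
  next
    case (Some j)
    have "x k j \<le> 1" if "k < Suc n"
    proof (cases "j \<in> A k")
      case True
      then have "x k j \<le> (\<Sum>j\<in>A k. x k j)"
        by (intro member_le_sum) (use x(1) that in \<open>auto simp: A_def\<close>)
      also have "\<dots> = 1" using x(3)[OF that] True by blast
      finally show ?thesis .
    next
      case False
      then show ?thesis using x(2) that by simp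
    qed
    then show ?thesis using x(1)[of k j] Some by (auto simp: y_def)
  qed
  have g_meas: "g \<in> M \<rightarrow>\<^sub>M count_space UNIV"
    unfolding g_def
  proof (rule measurable_card)
    fix i
    show "{x \<in> space M. i \<in> {j. j < n \<and> t j \<le> x}} \<in> sets M"
      unfolding space_eq by (rule Collect_in_sets) (cases "i < n"; simp)
  qed
  have "(\<lambda>d. y (g d) a) \<in> M \<rightarrow>\<^sub>M restrict_space borel {0..1}" if "a \<in> all_strategies n" for a
    by (rule measurable_compose[OF g_meas])
       (use y_range[OF that] in \<open>auto simp: measurable_count_space_eq1 space_restrict_space\<close>)
  then have "s \<in> M \<rightarrow>\<^sub>M Pi\<^sub>M (all_strategies n) (\<lambda>_. restrict_space borel {0..1})"
    unfolding s_def by (intro measurable_restrict)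
  moreover have "supp n (s d) \<subseteq> type_strategies n t d" for d
  proof
    fix a assume a: "a \<in> supp n (s d)"
    show "a \<in> type_strategies n t d"
    proof (cases a)
      case None
      then show ?thesis by (simp add: type_strategies_def)
    next
      case (Some j)
      then have "j \<in> A (g d)"
        using a x(2)[OF gn, of j d] by (auto simp: supp_def s_def y_def split: if_splits)
      then show ?thesis using Some by (auto simp: A type_strategies_def)
    qed
  qed
  ultimately have p: "consumption_profile M n t s"
    unfolding consumption_profile_def using y_sum by (auto simp: s_def)
  have load: "profile_load M s j = (\<Sum>l<Suc n. m l * x l j)" if "j < n" for j
  proof -
    \<comment> \<open>The demand for \<open>j\<close> is constant on each group
      \<open>g d = l\<close>, so its integral is the load that the balanced assignment
      controls.\<close>
    have "x (g d) j = (\<Sum>l<Suc n. x l j * indicator {d \<in> space M. g d = l} d)"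
      if "d \<in> space M" for d
    proof -
      have "(\<Sum>l<Suc n. x l j * indicator {d \<in> space M. g d = l} d)
        = (\<Sum>l<Suc n. if l = g d then x l j else 0)"
        by (intro sum.cong) (use that in \<open>auto simp: indicator_def\<close>)
      then show ?thesis using gn[of d] by simp
    qed
    then have "profile_load M s j
      = (LINT d|M. (\<Sum>l<Suc n. x l j * indicator {d \<in> space M. g d = l} d))"
      unfolding profile_load_def
      by (intro Bochner_Integration.integral_cong)
         (use that gn in \<open>auto simp: s_def y_def all_strategies_def\<close>)
    also have "\<dots> = (\<Sum>l<Suc n. (LINT d|M. (x l j * indicator {d \<in> space M. g d = l} d)))"
    proof (rule Bochner_Integration.integral_sum)
      fix l
      have "{d \<in> space M. g d = l} \<in> sets M"
        using measurable_sets[OF g_meas, of "{l}"]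
        by (simp add: vimage_def Int_def conj_commute)
      then show "integrable M (\<lambda>d. x l j * indicator {d \<in> space M. g d = l} d)"
        by (intro integrable_mult_right integrable_real_indicator)
           (auto simp: emeasure_finite less_top[symmetric])
    qed
    also have "\<dots> = (\<Sum>l<Suc n. m l * x l j)"
      by (intro sum.cong) (auto simp: m_def mult.commute intro!: arg_cong[of _ _ "measure M"])
    finally show ?thesis .
  qed
  have "consumer_nash M n t s"
    unfolding consumer_nash_def
  proof (intro conjI ballI allI impI)
    fix d :: real
    show "type_strategies n t d = {None}" if "None \<in> supp n (s d)"
    proof -
      have "A (g d) = {}"
        using that by (auto simp: supp_def s_def y_def all_strategies_def split: if_splits)
      then show ?thesis by (auto simp: A type_strategies_def)
    qed
    show "profile_load M s k \<le> profile_load M s j"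
      if "Some k \<in> supp n (s d)" "Some j \<in> type_strategies n t d" for k j
    proof -
      have "k < n" "x (g d) k \<noteq> 0"
        using that by (auto simp: supp_def s_def y_def all_strategies_def split: if_splits)
      moreover have "j < n" "j \<in> A (g d)"
        using that by (auto simp: type_strategies_def A)
      ultimately show ?thesis using x(4)[OF gn] by (simp add: load)
    qed
  qed (rule p)
  then show ?thesis by blast
qed

section \<open>Loads as functions of the prices\<close>

lemma load_eq:
  assumes s: "consumer_nash M n t s" and j: "j < n"
  shows "load M n t j = profile_load M s j"
  unfolding load_def
proof (rule the_equality)
  show "\<exists>s'. consumer_nash M n t s' \<and> profile_load M s j = profile_load M s' j"
    using s by blast
next
  fix x assume "\<exists>s'. consumer_nash M n t s' \<and> x = profile_load M s' j"
  then show "x = profile_load M s j"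
    using profile_load_unique[OF _ s j] by blast
qed

text \<open>A consumer served by \<open>k\<close> can also afford \<open>j\<close>, so optimality
  compares the loads; if \<open>k\<close> serves nobody, its load is 0.\<close>

lemma load_antimono:
  assumes "j < n" "k < n" "t j \<le> t k"
  shows "load M n t k \<le> load M n t j"
proof -
  obtain s where s: "consumer_nash M n t s" using consumer_nash_exists by blast
  then have p: "consumption_profile M n t s" by (simp add: consumer_nash_def)
  show ?thesis
  proof (cases "\<exists>d\<in>{0..1}. s d (Some k) \<noteq> 0")
    case True
    then obtain d where d: "d \<in> {0..1}" "s d (Some k) \<noteq> 0" by blast
    then have "t j \<le> d" using consumption_profileD(4)[OF p d(1), of k] assms by force
    then show ?thesis
      using consumer_nashD(2)[OF s d(1) assms(1) _ assms(2) d(2)] assms by (simp add: load_eq[OF s])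
  next
    case False
    then have "profile_load M s k = (LINT d|M. 0)"
      unfolding profile_load_def
      by (intro Bochner_Integration.integral_cong) (simp_all add: space_eq)
    then have "profile_load M s k = 0" by simp
    moreover have "0 \<le> profile_load M s j"
      unfolding profile_load_def using consumption_profileD(2)[OF p] assms
      by (intro Bochner_Integration.integral_nonneg) (simp add: space_eq)
    ultimately show ?thesis using assms by (simp add: load_eq[OF s])
  qed
qed

text \<open>The producers in \<open>U\<close> serve only types from \<open>v\<close> upwards, each
  with total weight at most 1.\<close>

lemma sum_load_le:
  assumes U: "U \<subseteq> {..<n}" and v: "\<And>k. k \<in> U \<Longrightarrow> v \<le> t k"
  shows "(\<Sum>k\<in>U. load M n t k) \<le> measure M {d \<in> {0..1}. v \<le> d}"
proof -
  obtain s where s: "consumer_nash M n t s" using consumer_nash_exists by blast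
  then have p: "consumption_profile M n t s" by (simp add: consumer_nash_def)
  let ?T = "{d \<in> {0..1}. v \<le> d}"
  have T: "?T \<in> sets M" by (rule Collect_in_sets) simp
  have "(\<Sum>k\<in>U. load M n t k) = (\<Sum>k\<in>U. 1 * profile_load M s k)"
    using U by (intro sum.cong) (auto simp: load_eq[OF s])
  also have "\<dots> = (LINT d|M. (\<Sum>k\<in>U. 1 * s d (Some k)))"
    by (rule sum_profile_load(2)[OF p U])
  also have "\<dots> \<le> (LINT d|M. indicator ?T d)"
  proof (rule integral_mono[OF sum_profile_load(1)[OF p U]])
    show "integrable M (indicator ?T :: real \<Rightarrow> real)"
      using T by (intro integrable_real_indicator)
           (auto simp: emeasure_finite less_top[symmetric])
    show "(\<Sum>k\<in>U. 1 * s d (Some k)) \<le> indicator ?T d" if "d \<in> space M" for d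
    proof -
      have d: "d \<in> {0..1}" using that by (simp add: space_eq)
      note D = consumption_profileD[OF p d]
      show ?thesis
      proof (cases "v \<le> d")
        case True
        have "(\<Sum>k\<in>U. s d (Some k)) \<le> (\<Sum>k<n. s d (Some k))"
          using U D(2) by (intro sum_mono2) auto
        also have "\<dots> \<le> 1" using D(1,3) by simp
        finally show ?thesis using True d by simp
      next
        case False
        then have "s d (Some k) = 0" if "k \<in> U" for k
          using D(4)[of k] v[OF that] U that by force
        then show ?thesis by simp
      qed
    qed
  qed
  also have "\<dots> = measure M ?T"
    using sets.sets_into_space[OF T] by (simp add: Int_absorb2)
  finally show ?thesis .
qed

text \<open>Every type that can afford \<open>i\<close> does consume, and only from producers whose
  load is at most that of \<open>i\<close>, hence below \<open>c\<close>.\<close>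

lemma sum_load_ge:
  assumes i: "i < n" "load M n t i < c"
  shows "measure M {d \<in> {0..1}. t i \<le> d} \<le> (\<Sum>k | k < n \<and> load M n t k < c. load M n t k)"
proof -
  obtain s where s: "consumer_nash M n t s" using consumer_nash_exists by blast
  then have p: "consumption_profile M n t s" by (simp add: consumer_nash_def)
  let ?T = "{d \<in> {0..1}. t i \<le> d}" and ?Z = "{k. k < n \<and> load M n t k < c}"
  have T: "?T \<in> sets M" by (rule Collect_in_sets) simp
  have Z: "?Z \<subseteq> {..<n}" by auto
  have "measure M ?T = (LINT d|M. indicator ?T d)"
    using sets.sets_into_space[OF T] by (simp add: Int_absorb2)
  also have "\<dots> \<le> (LINT d|M. (\<Sum>k\<in>?Z. 1 * s d (Some k)))"
  proof (rule integral_mono[OF _ sum_profile_load(1)[OF p Z]])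
    show "integrable M (indicator ?T :: real \<Rightarrow> real)"
      using T by (intro integrable_real_indicator)
           (auto simp: emeasure_finite less_top[symmetric])
    show "indicator ?T d \<le> (\<Sum>k\<in>?Z. 1 * s d (Some k))" if "d \<in> space M" for d
    proof -
      have d: "d \<in> {0..1}" using that by (simp add: space_eq)
      show ?thesis
      proof (cases "t i \<le> d")
        case True
        have "(\<Sum>k\<in>?Z. s d (Some k)) = (\<Sum>k<n. s d (Some k))"
        proof (rule sum.mono_neutral_left)
          show "\<forall>k\<in>{..<n} - ?Z. s d (Some k) = 0"
          proof
            fix k assume k: "k \<in> {..<n} - ?Z"
            then show "s d (Some k) = 0"
              using consumer_nashD(2)[OF s d i(1) True, of k] i by (force simp: load_eq[OF s])
          qed
        qed auto
        then show ?thesis using consumer_nash_sum[OF s d i(1) True] by simp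
      next
        case False
        then show ?thesis using consumption_profileD(2)[OF p d] by (auto intro!: sum_nonneg)
      qed
    qed
  qed
  also have "\<dots> = (\<Sum>k\<in>?Z. 1 * profile_load M s k)"
    by (rule sum_profile_load(2)[OF p Z, symmetric])
  also have "\<dots> = (\<Sum>k\<in>?Z. load M n t k)"
    by (intro sum.cong) (auto simp: load_eq[OF s])
  finally show ?thesis .
qed

section \<open>The average load, feasible and saturated prices\<close>

lemma initial_in_sets:
  assumes "v \<le> 1"
  shows "{0..<v} \<in> sets M"
proof -
  have "{0..<v} = {d \<in> {0..1}. d < v}" using assms by auto
  then show ?thesis using Collect_in_sets[of "\<lambda>d. d < v"] by simp
qed

lemma measure_initial_mono: "u \<le> v \<Longrightarrow> v \<le> 1 \<Longrightarrow> measure M {0..<u} \<le> measure M {0..<v}"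
  by (rule finite_measure_mono[OF _ initial_in_sets]) auto

lemma measure_final:
  assumes "v \<in> {0..1}"
  shows "measure M {d \<in> {0..1}. v \<le> d} = measure M {0..1} - measure M {0..<v}"
proof -
  have "{d \<in> {0..1}. v \<le> d} = space M - {0..<v}"
    using assms by (auto simp: space_eq)
  then show ?thesis
    using finite_measure_compl[OF initial_in_sets, of v] assms by (simp add: space_eq)
qed

definition share :: real where
  "share = measure M {0..1} / real n"

lemma share_mult: "share * real n = measure M {0..1}"
  using n_pos by (simp add: share_def)

lemma share_nonneg: "0 \<le> share"
  by (simp add: share_def)

text \<open>The witness is the cheapest producer with load below \<open>share\<close>: all consumers who can afford it
  are served by producers with load below \<open>share\<close>, which bounds their mass.\<close>

lemma low_load:
  assumes t: "\<And>j. j < n \<Longrightarrow> t j \<in> {0..1}" and low: "\<exists>j<n. load M n t j < share"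
  obtains i where "i < n" "load M n t i < share"
    "{k. k < n \<and> t k < t i} = {k. k < n \<and> share \<le> load M n t k}"
    "share * real (card {k. k < n \<and> t k < t i}) < measure M {0..<t i}"
proof -
  let ?Z = "{k. k < n \<and> load M n t k < share}"
  have Z: "finite ?Z" "?Z \<noteq> {}" using low by auto
  then have "Min (t ` ?Z) \<in> t ` ?Z" by simp
  then obtain i where i: "i < n" "load M n t i < share" "t i = Min (t ` ?Z)" by auto
  have min: "t i \<le> t k" if "k < n" "load M n t k < share" for k
    unfolding i(3) using that Z by (intro Min_le) auto
  \<comment> \<open>A producer with load at least \<open>share\<close> must be cheaper than
    \<open>i\<close>, as loads do not increase with the price; a producer cheaper than
    \<open>i\<close> cannot have low load, by the choice of \<open>i\<close>.\<close>
  have eq: "{k. k < n \<and> t k < t i} = {k. k < n \<and> share \<le> load M n t k}"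
  proof (intro Collect_cong conj_cong refl)
    fix k assume k: "k < n"
    show "t k < t i \<longleftrightarrow> share \<le> load M n t k"
      using min[OF k] load_antimono[OF i(1) k, of t] i(2) by linarith
  qed
  have "measure M {0..1} - measure M {0..<t i} \<le> (\<Sum>k\<in>?Z. load M n t k)"
    using sum_load_ge[OF i(1,2)] measure_final[OF t[OF i(1)]] by simp
  also have "\<dots> < (\<Sum>k\<in>?Z. share)"
    using Z by (intro sum_strict_mono) auto
  also have "\<dots> = share * (real n - real (card {k. k < n \<and> t k < t i}))"
    using card_split[of n "\<lambda>k. load M n t k < share"] by (simp add: eq not_less)
  finally have "share * real (card {k. k < n \<and> t k < t i}) < measure M {0..<t i}"
    using share_mult by (simp add: algebra_simps)
  then show ?thesis using that i eq by blast
qed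

text \<open>The loads sum to at most the total mass, so if none is below the average, none is above
  it.\<close>

lemma load_eq_share:
  assumes t: "\<And>j. j < n \<Longrightarrow> t j \<in> {0..1}" and ge: "\<And>j. j < n \<Longrightarrow> share \<le> load M n t j"
    and j: "j < n"
  shows "load M n t j = share"
proof -
  have "{d \<in> {0..1}. 0 \<le> d} = {0..1::real}" by auto
  then have "(\<Sum>k<n. load M n t k) \<le> (\<Sum>k<n. share)"
    using sum_load_le[of "{..<n}" 0 t] t share_mult by (simp add: mult.commute)
  moreover have "(\<Sum>k<n. share) \<le> (\<Sum>k<n. load M n t k)"
    using ge by (intro sum_mono) auto
  ultimately have "(\<Sum>k<n. share) = (\<Sum>k<n. load M n t k)" by simp
  then show ?thesis
    using sum_mono_inv[of "\<lambda>_. share" "{..<n}" "load M n t" j] ge j by simp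
qed

text \<open>Together, \<open>feasible\<close> and \<open>saturated\<close> are the description of the sorted prices as maxima,
  phrased symmetrically in the producers.\<close>

definition feasible :: "(nat \<Rightarrow> real) \<Rightarrow> bool" where
  "feasible t \<longleftrightarrow> (\<forall>j<n. measure M {0..<t j} \<le> share * real (card {i. i < n \<and> t i < t j}))"

definition saturated :: "(nat \<Rightarrow> real) \<Rightarrow> bool" where
  "saturated t \<longleftrightarrow> (\<forall>x\<in>{0..1}. (\<exists>j<n. t j < x) \<longrightarrow>
     share * (real (card {i. i < n \<and> t i < x}) - 1) < measure M {0..<x})"

text \<open>A load below \<open>share\<close> yields, by \<open>low_load\<close>, a price that
  violates feasibility. Conversely, the producers priced at least \<open>t j\<close> receive
  \<open>share\<close> each from types at least \<open>t j\<close>, which bounds the mass of the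
  lower types.\<close>

lemma feasible_iff:
  assumes t: "\<And>j. j < n \<Longrightarrow> t j \<in> {0..1}"
  shows "feasible t \<longleftrightarrow> (\<forall>j<n. load M n t j = share)"
proof
  assume f: "feasible t"
  have "\<not> (\<exists>j<n. load M n t j < share)"
  proof
    assume "\<exists>j<n. load M n t j < share"
    with t show False
      by (rule low_load) (use f in \<open>auto simp: feasible_def\<close>)
  qed
  then have "share \<le> load M n t j" if "j < n" for j
    using that by (meson not_le)
  then show "\<forall>j<n. load M n t j = share"
    using load_eq_share[of t, OF t] by blast
next
  assume eq: "\<forall>j<n. load M n t j = share"
  show "feasible t"
    unfolding feasible_def
  proof (intro allI impI)
    fix j assume j: "j < n"
    let ?U = "{k. k < n \<and> \<not> t k < t j}"
    have "share * real (card ?U) = (\<Sum>k\<in>?U. load M n t k)"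
      using eq by simp
    also have "\<dots> \<le> measure M {0..1} - measure M {0..<t j}"
      using sum_load_le[of ?U "t j" t] measure_final[OF t[OF j]] by auto
    finally show "measure M {0..<t j} \<le> share * real (card {i. i < n \<and> t i < t j})"
      using card_split[of n "\<lambda>k. t k < t j"] share_mult by (simp add: algebra_simps)
  qed
qed

section \<open>Producer equilibria and coalitions\<close>

lemma producer_profiles_range: "t \<in> producer_profiles n \<Longrightarrow> j < n \<Longrightarrow> t j \<in> {0..1}"
  unfolding producer_profiles_def by (erule PiE_mem) simp

text \<open>A producer offering the price \<open>0\<close> attracts at least the average load, since no other
  producer can have a higher load.\<close>

lemma producer_nash_load:
  assumes nash: "producer_nash M n t" and j: "j < n"
  shows "load M n t j = share"
proof -
  have t: "t j \<in> {0..1}" if "j < n" for j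
    using that nash producer_profiles_range by (simp add: producer_nash_def)
  have "share \<le> load M n t j" if j: "j < n" for j
  proof -
    let ?u = "t(j := 0)"
    have u: "?u k \<in> {0..1}" if "k < n" for k
      using t[OF that] by simp
    have "share \<le> load M n ?u j"
    proof (rule ccontr)
      assume low: "\<not> share \<le> load M n ?u j"
      then have "\<exists>j<n. load M n ?u j < share" using j by (auto simp: not_le)
      with u show False
      proof (rule low_load)
        fix i assume i: "i < n" "{k. k < n \<and> ?u k < ?u i} = {k. k < n \<and> share \<le> load M n ?u k}"
          "share * real (card {k. k < n \<and> ?u k < ?u i}) < measure M {0..<?u i}"
        \<comment> \<open>As \<open>j\<close> itself has low load, it is not cheaper than the
          witness \<open>i\<close>; so the price of \<open>i\<close> is at most 0 and no mass lies
          below it.\<close>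
        have "j \<notin> {k. k < n \<and> ?u k < ?u i}" using low unfolding i(2) by simp
        then have "?u i \<le> 0" using j by (auto simp: not_less)
        then have "measure M {0..<?u i} = 0" by simp
        moreover have "0 \<le> share * real (card {k. k < n \<and> ?u k < ?u i})"
          using share_nonneg by simp
        ultimately show False using i(3) by linarith
      qed
    qed
    also have "load M n ?u j \<le> load M n t j"
      using nash j by (force simp: producer_nash_def fine_weak_pref_def fine_strict_pref_def)
    finally show ?thesis .
  qed
  then show ?thesis using load_eq_share[of t, OF t] j by blast
qed

text \<open>If \<open>x\<close> violated saturation, the most expensive producer below \<open>x\<close> could raise its price
  to \<open>x\<close> while keeping its load.\<close>

lemma producer_nash_saturated:
  assumes nash: "producer_nash M n t"
  shows "saturated t"
  unfolding saturated_def
proof (intro ballI impI, rule ccontr)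
  fix x :: real
  assume x: "x \<in> {0..1}" and ex: "\<exists>j<n. t j < x"
    and "\<not> share * (real (card {i. i < n \<and> t i < x}) - 1) < measure M {0..<x}"
  then have le: "measure M {0..<x} \<le> share * (real (card {i. i < n \<and> t i < x}) - 1)" by simp
  have t: "t j \<in> {0..1}" if "j < n" for j
    using that nash producer_profiles_range by (simp add: producer_nash_def)
  have feas: "measure M {0..<t j} \<le> share * real (card {i. i < n \<and> t i < t j})" if "j < n" for j
    using that producer_nash_load[OF nash] feasible_iff[of t] t by (simp add: feasible_def)
  have "Max (t ` {i. i < n \<and> t i < x}) \<in> t ` {i. i < n \<and> t i < x}"
    using ex by (intro Max_in) auto
  then obtain j where j: "j < n" "t j < x" "t j = Max (t ` {i. i < n \<and> t i < x})" by auto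
  have max: "t i \<le> t j" if "i < n" "t i < x" for i
    unfolding j(3) using that by (intro Max_ge) auto
  let ?u = "t(j := x)"
  have u: "?u k \<in> {0..1}" if "k < n" for k
    using t[OF that] x by simp
  \<comment> \<open>Moving \<open>j\<close> up to \<open>x\<close> removes exactly one producer from
    those below \<open>x\<close>: this is the 1 subtracted in \<open>saturated\<close>.\<close>
  have "{i. i < n \<and> ?u i < x} = {i. i < n \<and> t i < x} - {j}" by auto
  then have "real (card {i. i < n \<and> ?u i < x}) = real (card {i. i < n \<and> t i < x}) - 1"
    using j ex by (subst of_nat_1[symmetric], subst of_nat_diff[symmetric])
      (auto simp: Suc_le_eq card_gt_0_iff)
  with le have at_x: "measure M {0..<x} \<le> share * real (card {i. i < n \<and> ?u i < x})" by simp
  have "feasible ?u"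
    unfolding feasible_def
  proof (intro allI impI)
    fix i assume i: "i < n"
    show "measure M {0..<?u i} \<le> share * real (card {k. k < n \<and> ?u k < ?u i})"
    proof (cases "?u i = x")
      case True
      then show ?thesis using at_x by simp
    next
      case False
      then have ij: "i \<noteq> j" by auto
      \<comment> \<open>If \<open>t i < x\<close>, then \<open>t i \<le> t j\<close> and
        \<open>j\<close> counts neither before nor after the raise; if \<open>t i > x\<close>, it
        counts both times.\<close>
      have "?u k < t i \<longleftrightarrow> t k < t i" for k
        using max[OF i] j(2) False ij by (cases "t i < x") auto
      then show ?thesis using feas[OF i] ij by simp
    qed
  qed
  then have "load M n ?u j = share"
    using feasible_iff[of ?u] u j by blast
  then have "fine_strict_pref M n j ?u t"
    using j producer_nash_load[OF nash j(1)] by (simp add: fine_strict_pref_def)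
  then show False
    using nash j x by (simp add: producer_nash_def fine_weak_pref_def)
qed

text \<open>Stated for feasible and saturated prices, so that singleton coalitions yield the
  equilibrium property in \<open>producer_nash_iff\<close> and arbitrary ones
  super-strength.\<close>

lemma no_improving_coalition:
  assumes t: "\<And>j. j < n \<Longrightarrow> t j \<in> {0..1}" and feas: "feasible t" and sat: "saturated t"
    and P: "P \<subseteq> {..<n}" and t': "\<And>j. j \<in> P \<Longrightarrow> t' j \<in> {0..1}"
    and weak: "\<And>j. j \<in> P \<Longrightarrow> fine_weak_pref M n j (override_on t t' P) t"
    and j: "j \<in> P"
  shows "\<not> fine_strict_pref M n j (override_on t t' P) t"
proof
  let ?u = "override_on t t' P"
  assume strict: "fine_strict_pref M n j ?u t"
  have u: "?u k \<in> {0..1}" if "k < n" for k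
    using t[OF that] t'[of k] by (simp add: override_on_def)
  have load_t: "load M n t k = share" if "k < n" for k
    using feasible_iff[of t] t feas that by blast
  have P_ge: "share \<le> load M n ?u k" if "k \<in> P" for k
    using weak[OF that] load_t[of k] P that
    by (auto simp: fine_weak_pref_def fine_strict_pref_def)
  have "\<not> (\<exists>j<n. load M n ?u j < share)"
  proof
    assume "\<exists>j<n. load M n ?u j < share"
    with u show False
    proof (rule low_load)
      fix i assume i: "i < n" "load M n ?u i < share"
        "{k. k < n \<and> ?u k < ?u i} = {k. k < n \<and> share \<le> load M n ?u k}"
        "share * real (card {k. k < n \<and> ?u k < ?u i}) < measure M {0..<?u i}"
      have "i \<notin> P" using P_ge[of i] i(2) by auto
      then have ui: "?u i = t i" by simp
      \<comment> \<open>Outsiders cheaper than \<open>i\<close> keep their prices, and members of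
        \<open>P\<close> have load at least \<open>share\<close>, which makes them cheaper than
        \<open>i\<close> by the choice of \<open>i\<close>. So feasibility of \<open>t\<close> at
        \<open>t i\<close> contradicts the low load.\<close>
      have "{k. k < n \<and> t k < t i} \<subseteq> {k. k < n \<and> ?u k < ?u i}"
      proof
        fix k assume k: "k \<in> {k. k < n \<and> t k < t i}"
        show "k \<in> {k. k < n \<and> ?u k < ?u i}"
        proof (cases "k \<in> P")
          case True
          then show ?thesis unfolding i(3) using k P_ge by simp
        next
          case False
          then show ?thesis using k ui by simp
        qed
      qed
      then have "card {k. k < n \<and> t k < t i} \<le> card {k. k < n \<and> ?u k < ?u i}"
        by (intro card_mono) auto
      then have "share * real (card {k. k < n \<and> t k < t i})
          \<le> share * real (card {k. k < n \<and> ?u k < ?u i})"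
        using share_nonneg by (intro mult_left_mono) auto
      moreover have "measure M {0..<t i} \<le> share * real (card {k. k < n \<and> t k < t i})"
        using feas i(1) by (simp add: feasible_def)
      ultimately show False using i(4) ui by simp
    qed
  qed
  then have "share \<le> load M n ?u k" if "k < n" for k
    using that by (meson not_le)
  then have load_u: "load M n ?u k = share" if "k < n" for k
    using load_eq_share[of ?u, OF u] that by blast
  then have feas_u: "feasible ?u" using feasible_iff[of ?u] u by blast
  \<comment> \<open>With all loads equal to \<open>share\<close> before and after, the preferences
    compare prices only.\<close>
  have ge: "t k \<le> ?u k" if "k < n" for k
    using weak[of k] load_t[OF that] load_u[OF that]
    by (cases "k \<in> P") (auto simp: fine_weak_pref_def fine_strict_pref_def)
  have jn: "j < n" using j P by auto
  then have gt: "t j < ?u j"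
    using strict load_t load_u by (simp add: fine_strict_pref_def)
  let ?x = "?u j"
  let ?S = "{i. i < n \<and> t i < ?x}"
  have "measure M {0..<?x} \<le> share * real (card {i. i < n \<and> ?u i < ?x})"
    using feas_u jn by (simp add: feasible_def)
  also have "\<dots> \<le> share * real (card (?S - {j}))"
  proof -
    \<comment> \<open>No price has dropped, so whoever is below \<open>?x\<close> now was below it
      before; \<open>j\<close> was below and is now at \<open>?x\<close>.\<close>
    have "{i. i < n \<and> ?u i < ?x} \<subseteq> ?S - {j}"
      using ge by (auto intro: le_less_trans)
    then have "card {i. i < n \<and> ?u i < ?x} \<le> card (?S - {j})"
      by (intro card_mono) auto
    then show ?thesis using share_nonneg by (intro mult_left_mono) auto
  qed
  also have "real (card (?S - {j})) = real (card ?S) - 1"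
  proof -
    have "Suc (card (?S - {j})) = card ?S"
      using jn gt by (intro card_Suc_Diff1) auto
    then show ?thesis by simp
  qed
  finally show False
    using sat u[OF jn] gt jn by (force simp: saturated_def)
qed

lemma producer_nash_iff:
  assumes prof: "t \<in> producer_profiles n"
  shows "producer_nash M n t \<longleftrightarrow> feasible t \<and> saturated t"
proof
  assume nash: "producer_nash M n t"
  then have "feasible t"
    using feasible_iff[of t] producer_profiles_range[OF prof] producer_nash_load by blast
  with nash show "feasible t \<and> saturated t" using producer_nash_saturated by blast
next
  assume fs: "feasible t \<and> saturated t"
  have "fine_weak_pref M n j t (t(j := x))" if j: "j < n" and x: "x \<in> {0..1}" for j x
  proof (rule ccontr)
    assume "\<not> fine_weak_pref M n j t (t(j := x))"
    then have strict: "fine_strict_pref M n j (t(j := x)) t"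
      by (simp add: fine_weak_pref_def)
    have eq: "override_on t (\<lambda>_. x) {j} = t(j := x)"
      by (auto simp: override_on_def)
    have "\<not> fine_strict_pref M n j (override_on t (\<lambda>_. x) {j}) t"
    proof (rule no_improving_coalition)
      show "fine_weak_pref M n k (override_on t (\<lambda>_. x) {j}) t" if "k \<in> {j}" for k
        using strict that unfolding eq by (auto simp: fine_weak_pref_def fine_strict_pref_def)
    qed (use fs j x producer_profiles_range[OF prof] in auto)
    with strict show False unfolding eq by blast
  qed
  with prof show "producer_nash M n t" by (simp add: producer_nash_def)
qed

lemma producer_nash_super_strong:
  assumes nash: "producer_nash M n t"
  shows "super_strong M n t"
proof -
  have prof: "t \<in> producer_profiles n" using nash by (simp add: producer_nash_def)
  have fs: "feasible t" "saturated t" using producer_nash_iff[OF prof] nash by auto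
  show ?thesis
    unfolding super_strong_def
    using nash no_improving_coalition[OF producer_profiles_range[OF prof] fs] by blast
qed

section \<open>Existence, sorted prices and uniqueness up to permutation\<close>

text \<open>The mass of \<open>{0..<x}\<close> is left-continuous in \<open>x\<close>, so the
  supremum satisfies the bound as well.\<close>

lemma maximum_exists:
  assumes c: "0 \<le> c"
  shows "\<exists>x. is_maximum x {x \<in> {0..1}. measure M {0..<x} \<le> c}"
proof -
  let ?S = "{x \<in> {0..1}. measure M {0..<x} \<le> c}"
  have S: "0 \<in> ?S" "bdd_above ?S" using c by (auto intro: bdd_aboveI[of _ 1])
  define s where "s = Sup ?S"
  have upper: "y \<le> s" if "y \<in> ?S" for y
    unfolding s_def using that S(2) by (rule cSup_upper)
  have s: "s \<in> {0..1}"
  proof -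
    have "s \<le> 1" unfolding s_def by (rule cSup_least) (use S(1) in blast, simp)
    then show ?thesis using upper[OF S(1)] by simp
  qed
  \<comment> \<open>These points increase to \<open>s\<close> from strictly below; where one is
    negative, its interval is empty.\<close>
  define y where "y k = s - inverse (real (Suc k))" for k
  have y_less: "y k < s" for k by (simp add: y_def)
  have le: "measure M {0..<y k} \<le> c" for k
  proof -
    have "\<exists>z\<in>?S. y k < z"
    proof (rule less_cSupD)
      show "?S \<noteq> {}" using S(1) by blast
      show "y k < Sup ?S" using y_less[of k] unfolding s_def .
    qed
    then obtain z where z: "z \<in> {0..1}" "measure M {0..<z} \<le> c" "y k < z" by blast
    have "measure M {0..<y k} \<le> measure M {0..<z}"
      using z by (intro measure_initial_mono) auto
    with z(2) show ?thesis by simp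
  qed
  have "(\<lambda>k. measure M {0..<y k}) \<longlonglongrightarrow> measure M (\<Union>k. {0..<y k})"
  proof (rule finite_Lim_measure_incseq)
    show "range (\<lambda>k. {0..<y k}) \<subseteq> sets M"
    proof -
      have "y k \<le> 1" for k using y_less[of k] s by simp
      then show ?thesis by (auto intro: initial_in_sets)
    qed
    show "incseq (\<lambda>k. {0..<y k})"
    proof (rule incseq_SucI)
      fix k
      have "y k \<le> y (Suc k)" unfolding y_def by (intro diff_mono le_imp_inverse_le) auto
      then show "{0..<y k} \<subseteq> {0..<y (Suc k)}" by auto
    qed
  qed
  moreover have "(\<Union>k. {0..<y k}) = {0..<s}"
  proof (intro equalityI subsetI)
    fix d assume "d \<in> (\<Union>k. {0..<y k})"
    then obtain k where "0 \<le> d" "d < y k" by auto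
    then show "d \<in> {0..<s}" using y_less[of k] by simp
  next
    fix d assume d: "d \<in> {0..<s}"
    then obtain k where "inverse (real (Suc k)) < s - d"
      using reals_Archimedean[of "s - d"] by auto
    then have "d \<in> {0..<y k}" using d by (simp add: y_def)
    then show "d \<in> (\<Union>k. {0..<y k})" by blast
  qed
  ultimately have "(\<lambda>k. measure M {0..<y k}) \<longlonglongrightarrow> measure M {0..<s}" by simp
  then have "measure M {0..<s} \<le> c"
    by (rule LIMSEQ_le_const2) (use le in blast)
  then show ?thesis using s upper unfolding is_maximum_def by blast
qed

text \<open>The maxima themselves form the equilibrium. They increase with \<open>j\<close> because
  the sets being maximized over are nested.\<close>

lemma producer_nash_exists: "\<exists>t. producer_nash M n t \<and> mono_on {..<n} t"
proof -
  have "\<forall>j. \<exists>x. is_maximum x {x \<in> {0..1}. measure M {0..<x} \<le> share * real j}"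
    using share_nonneg by (intro allI maximum_exists) simp
  then obtain T where T: "\<And>j. is_maximum (T j) {x \<in> {0..1}. measure M {0..<x} \<le> share * real j}"
    by metis
  have T01: "T j \<in> {0..1}" and T_le: "measure M {0..<T j} \<le> share * real j" for j
    using T[of j] by (auto simp: is_maximum_def)
  have T_gt: "share * real j < measure M {0..<x}" if "T j < x" "x \<in> {0..1}" for j x
  proof (rule ccontr)
    assume "\<not> share * real j < measure M {0..<x}"
    then have "x \<le> T j" using T[of j] that(2) by (simp add: is_maximum_def)
    with that(1) show False by simp
  qed
  define t where "t = restrict T {..<n}"
  have tT: "t j = T j" if "j < n" for j using that by (simp add: t_def)
  have "T i \<le> T j" if "i \<le> j" for i j
  proof (rule ccontr)
    assume "\<not> T i \<le> T j"
    then have "share * real j < share * real i"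
      using T_gt[of j "T i"] T01 T_le[of i] by simp
    moreover have "share * real i \<le> share * real j"
      using that share_nonneg by (intro mult_left_mono) auto
    ultimately show False by simp
  qed
  then have mono: "mono_on {..<n} t" by (auto intro!: mono_onI simp: tT)
  have prof: "t \<in> producer_profiles n" using T01 by (auto simp: producer_profiles_def t_def)
  have "feasible t"
    unfolding feasible_def
  proof (intro allI impI)
    fix j assume j: "j < n"
    \<comment> \<open>With ties, fewer than \<open>j\<close> producers may be cheaper. The index
      \<open>a\<close> is the first one with price \<open>t j\<close>, so the bound for
      \<open>T a\<close> is the required one.\<close>
    define a where "a = card {i. i < n \<and> t i < t j}"
    have a: "{i. i < n \<and> t i < t j} = {..<a}"
      unfolding a_def by (rule mono_on_less_eq_lessThan[OF mono])
    have "j \<notin> {..<a}" unfolding a[symmetric] by simp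
    then have an: "a < n" using j by simp
    have "a \<notin> {i. i < n \<and> t i < t j}" unfolding a by simp
    then have "T j \<le> T a" using an j by (simp add: tT)
    then have "measure M {0..<t j} \<le> measure M {0..<T a}"
      using measure_initial_mono[of "T j" "T a"] T01[of a] j by (simp add: tT)
    also have "\<dots> \<le> share * real a" by (rule T_le)
    finally show "measure M {0..<t j} \<le> share * real (card {i. i < n \<and> t i < t j})"
      by (simp add: a_def)
  qed
  moreover have "saturated t"
    unfolding saturated_def
  proof (intro ballI impI)
    fix x :: real assume x: "x \<in> {0..1}" and "\<exists>j<n. t j < x"
    then have "{i. i < n \<and> t i < x} \<noteq> {}" by auto
    then have "card {i. i < n \<and> t i < x} \<noteq> 0" by simp
    \<comment> \<open>The last index priced below \<open>x\<close> is \<open>b\<close>, one less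
      than the count, so the maximality of \<open>T b\<close> gives the strict inequality.\<close>
    then obtain b where b: "card {i. i < n \<and> t i < x} = Suc b" by (metis not0_implies_Suc)
    have "{i. i < n \<and> t i < x} = {..<Suc b}"
      using mono_on_less_eq_lessThan[OF mono, of x] unfolding b .
    then have "b \<in> {i. i < n \<and> t i < x}" by blast
    then have "T b < x" using tT[of b] by auto
    then show "share * (real (card {i. i < n \<and> t i < x}) - 1) < measure M {0..<x}"
      using T_gt[of b x] x b by simp
  qed
  ultimately show ?thesis using producer_nash_iff[OF prof] mono by blast
qed

text \<open>At most \<open>j\<close> producers are cheaper than the one at index \<open>j\<close>,
  so feasibility gives membership; above \<open>t j\<close> there are at least \<open>j + 1\<close>
  cheaper ones, so saturation excludes a larger member.\<close>

lemma sorted_is_maximum: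
  assumes t: "\<And>j. j < n \<Longrightarrow> t j \<in> {0..1}" and feas: "feasible t" and sat: "saturated t"
    and mono: "mono_on {..<n} t" and j: "j < n"
  shows "is_maximum (t j) {x \<in> {0..1}. measure M {0..<x} \<le> share * real j}"
  unfolding is_maximum_def
proof (intro conjI ballI)
  have "{i. i < n \<and> t i < t j} \<subseteq> {..<j}"
  proof
    fix i assume i: "i \<in> {i. i < n \<and> t i < t j}"
    then have "\<not> j \<le> i" using mono_onD[OF mono, of j i] j by auto
    then show "i \<in> {..<j}" by simp
  qed
  then have "card {i. i < n \<and> t i < t j} \<le> card {..<j}"
    by (intro card_mono) auto
  then have "share * real (card {i. i < n \<and> t i < t j}) \<le> share * real j"
    using share_nonneg by (intro mult_left_mono) auto
  then show "t j \<in> {x \<in> {0..1}. measure M {0..<x} \<le> share * real j}"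
    using t[OF j] feas j by (force simp: feasible_def)
next
  fix y assume y: "y \<in> {x \<in> {0..1}. measure M {0..<x} \<le> share * real j}"
  show "y \<le> t j"
  proof (rule ccontr)
    assume less: "\<not> y \<le> t j"
    have "{..j} \<subseteq> {i. i < n \<and> t i < y}"
    proof
      fix i assume "i \<in> {..j}"
      then show "i \<in> {i. i < n \<and> t i < y}"
        using mono_onD[OF mono, of i j] j less by auto
    qed
    then have "card {..j} \<le> card {i. i < n \<and> t i < y}"
      by (intro card_mono) auto
    then have "share * real j \<le> share * (real (card {i. i < n \<and> t i < y}) - 1)"
      using share_nonneg by (intro mult_left_mono) auto
    also have "\<dots> < measure M {0..<y}"
      using sat y less j unfolding saturated_def by (auto simp: not_le)
    finally show False using y by simp
  qed
qed

lemma producer_nash_sorted: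
  assumes nash: "producer_nash M n t"
  shows "\<exists>p. p permutes {..<n} \<and>
    (\<forall>j<n. is_maximum (t (p j)) {x \<in> {0..1}. measure M {0..<x} \<le> share * real j})"
proof -
  obtain p where p: "p permutes {..<n}" and mono: "mono_on {..<n} (\<lambda>i. t (p i))"
    by (rule sorting_permutation)
  have pn: "p i < n \<longleftrightarrow> i < n" for i using permutes_in_image[OF p, of i] by simp
  have prof: "t \<in> producer_profiles n" using nash by (simp add: producer_nash_def)
  have fs: "feasible t" "saturated t" using producer_nash_iff[OF prof] nash by auto
  have "feasible (\<lambda>i. t (p i))"
    using fs(1) pn by (simp add: feasible_def permuted_card_less[OF p])
  moreover have "saturated (\<lambda>i. t (p i))"
    using fs(2) pn unfolding saturated_def permuted_card_less[OF p] by blast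
  ultimately show ?thesis
    using p sorted_is_maximum[OF _ _ _ mono] producer_profiles_range[OF prof] pn by blast
qed

text \<open>Both equilibria sort to the same maxima; composing one sorting permutation with the
  inverse of the other relates them.\<close>

lemma producer_nash_unique:
  assumes "producer_nash M n t" "producer_nash M n t'"
  shows "\<exists>\<pi>. \<pi> permutes {..<n} \<and> (\<forall>j<n. t' j = t (\<pi> j))"
proof -
  obtain p where p: "p permutes {..<n}"
    "\<And>j. j < n \<Longrightarrow> is_maximum (t (p j)) {x \<in> {0..1}. measure M {0..<x} \<le> share * real j}"
    using producer_nash_sorted[OF assms(1)] by blast
  obtain q where q: "q permutes {..<n}"
    "\<And>j. j < n \<Longrightarrow> is_maximum (t' (q j)) {x \<in> {0..1}. measure M {0..<x} \<le> share * real j}"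
    using producer_nash_sorted[OF assms(2)] by blast
  have "t' j = t ((p \<circ> inv q) j)" if "j < n" for j
  proof -
    have "inv q j < n" using permutes_in_image[OF permutes_inv[OF q(1)], of j] that by simp
    then have "t' (q (inv q j)) = t (p (inv q j))" by (intro is_maximum_unique[OF q(2) p(2)])
    then show ?thesis by (simp add: permutes_inverses[OF q(1)])
  qed
  moreover have "p \<circ> inv q permutes {..<n}"
    by (rule permutes_compose[OF permutes_inv[OF q(1)] p(1)])
  ultimately show ?thesis by (intro exI[of _ "p \<circ> inv q"]) simp
qed

end

theorem theorem4p28:
  fixes n :: nat and M :: "real measure"
  assumes "n \<ge> 1"
    and "finite_measure M"
    and "sets M = sets (restrict_space borel {0..1})"
  shows "(\<exists>t. producer_nash M n t \<and> mono_on {..<n} t) \<and>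
    (\<forall>t t'. producer_nash M n t \<longrightarrow> producer_nash M n t' \<longrightarrow>
       (\<exists>\<pi>. \<pi> permutes {..<n} \<and> (\<forall>j<n. t' j = t (\<pi> j)))) \<and>
    (\<forall>t. producer_nash M n t \<longrightarrow> mono_on {..<n} t \<longrightarrow>
       (\<forall>j<n. is_maximum (t j)
          {x \<in> {0..1}. measure M {0..<x} \<le> real j / real n * measure M {0..1}})) \<and>
    (\<forall>t. producer_nash M n t \<longrightarrow>
       (\<forall>j<n. load M n t j = measure M {0..1} / real n)) \<and>
    (\<forall>t. producer_nash M n t \<longrightarrow> super_strong M n t)"
proof -
  interpret finite_measure M by fact
  interpret consumer_market M n by unfold_locales fact+
  have "is_maximum (t j) {x \<in> {0..1}. measure M {0..<x} \<le> real j / real n * measure M {0..1}}"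
    if nash: "producer_nash M n t" and mono: "mono_on {..<n} t" and j: "j < n" for t j
  proof -
    have prof: "t \<in> producer_profiles n" using nash by (simp add: producer_nash_def)
    have "real j / real n * measure M {0..1} = share * real j" by (simp add: share_def)
    then show ?thesis
      using sorted_is_maximum[OF producer_profiles_range[OF prof] _ _ mono j]
        producer_nash_iff[OF prof] nash by simp
  qed
  then show ?thesis
    using producer_nash_exists producer_nash_unique producer_nash_super_strong
      producer_nash_load[unfolded share_def] by blast
qed

end
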